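(* Let $m\ge1$ and let $\{A(k)\}_{k\ge0}$ be a chain of $m\times m$ doubly stochastic matrices. Then $\{A(k)\}$ is ergodic if and only if it has the absolute infinite flow property.
   Context: $[m]=\{1,\dots,m\}$; $S\subset[m]$ denotes a proper subset, and $\bar S=[m]\setminus S$. A matrix is stochastic if its entries are nonnegative and each row sums to $1$; it is doubly stochastic if both it and its transpose are stochastic. A vector is stochastic if its entries are nonnegative and sum to $1$; $e$ is the all-ones column vector. For $k>s\ge 0$, $A(k:s)=A(k-1)A(k-2)\cdots A(s)$. The chain $\{A(k)\}$ is ergodic if for every $s\ge0$ there is a stochastic vector $v(s)$ with $\lim_{k\to\infty}A(k:s)=e\,v(s)^T$. A sequence $\{S(k)\}_{k\ge0}$ of sets $S(k)\subset[m]$ is regular if $|S(k)|=|S(0)|\neq 0$ for all $k\ge 0$. For a regular sequence define $$A_{S(k+1),S(k)}(k)=\sum_{i\in S(k+1),\,j\in\bar S(k)}A_{ij}(k)+\sum_{i\in\bar S(k+1),\,j\in S(k)}A_{ij}(k),\qquad F(\{A(k)\};\{S(k)\})=\sum_{k=0}^\infty A_{S(k+1),S(k)}(k).$$ The chain $\{A(k)\}$ has the absolute infinite flow property if $F(\{A(k)\};\{S(k)\})=\infty$ for every regular sequence $\{S(k)\}$. *)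

theory Defs
  imports "HOL-Analysis.Analysis"
begin

text \<open>The index set \<open>[m]\<close> is the finite type \<open>'n\<close>, so \<open>m = CARD('n) \<ge> 1\<close> is arbitrary.\<close>

definition stochastic_matrix :: "real^'n^'n \<Rightarrow> bool" where
  "stochastic_matrix A \<longleftrightarrow> (\<forall>i j. 0 \<le> A $ i $ j) \<and> (\<forall>i. (\<Sum>j\<in>UNIV. A $ i $ j) = 1)"

definition doubly_stochastic_matrix :: "real^'n^'n \<Rightarrow> bool" where
  "doubly_stochastic_matrix A \<longleftrightarrow> stochastic_matrix A \<and> stochastic_matrix (transpose A)"

definition stochastic_vector :: "real^'n \<Rightarrow> bool" where
  "stochastic_vector v \<longleftrightarrow> (\<forall>i. 0 \<le> v $ i) \<and> (\<Sum>i\<in>UNIV. v $ i) = 1"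

text \<open>\<open>backward_product A k s = A (k - 1) ** A (k - 2) ** \<dots> ** A s\<close> for \<open>k > s\<close>;
  for \<open>k \<le> s\<close> it is the identity matrix by convention.\<close>

primrec backward_product :: "(nat \<Rightarrow> real^'n^'n) \<Rightarrow> nat \<Rightarrow> nat \<Rightarrow> real^'n^'n" where
  "backward_product A 0 s = mat 1"
| "backward_product A (Suc k) s = (if s \<le> k then A k ** backward_product A k s else mat 1)"

definition ergodic_chain :: "(nat \<Rightarrow> real^'n^'n) \<Rightarrow> bool" where
  "ergodic_chain A \<longleftrightarrow>
     (\<forall>s. \<exists>v. stochastic_vector v \<and>
        (\<lambda>k. backward_product A k s) \<longlonglongrightarrow> (columnvector (vec 1) :: real^1^'n) ** rowvector v)"

text \<open>Each \<open>S k\<close> has to be a proper subset of the index set: for the constant sequence \<open>UNIV\<close>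
  every flow vanishes.\<close>

definition regular_sequence :: "(nat \<Rightarrow> 'n::finite set) \<Rightarrow> bool" where
  "regular_sequence S \<longleftrightarrow> (\<forall>k. S k \<subset> UNIV) \<and> (\<forall>k. card (S k) = card (S 0) \<and> card (S 0) \<noteq> 0)"

definition set_flow :: "real^'n^'n \<Rightarrow> 'n set \<Rightarrow> 'n set \<Rightarrow> real" where
  "set_flow A T S = (\<Sum>i\<in>T. \<Sum>j\<in>-S. A $ i $ j) + (\<Sum>i\<in>-T. \<Sum>j\<in>S. A $ i $ j)"

text \<open>The embedding into the extended nonnegative reals loses no information for chains of
  stochastic matrices, whose flows are nonnegative.\<close>

definition total_flow :: "(nat \<Rightarrow> real^'n^'n) \<Rightarrow> (nat \<Rightarrow> 'n set) \<Rightarrow> ennreal" where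
  "total_flow A S = (\<Sum>k. ennreal (set_flow (A k) (S (Suc k)) (S k)))"

definition absolute_infinite_flow :: "(nat \<Rightarrow> real^'n^'n) \<Rightarrow> bool" where
  "absolute_infinite_flow A \<longleftrightarrow> (\<forall>S. regular_sequence S \<longrightarrow> total_flow A S = \<infinity>)"

end

theory Submission
  imports Defs
begin

text \<open>
  For doubly stochastic matrices both implications come from following a trajectory
  \<open>x (k + 1) = A k x k\<close>, whose total mass \<open>\<Sum>i. x k $ i\<close> is constant. The chain is ergodic exactly when
  the coordinates of every trajectory, from every starting time, tend to a common limit.

  \<^bold>\<open>Ergodicity implies infinite flow.\<close> Suppose that the total flow along a regular sequence \<open>S\<close> is
  finite. Start at a late time \<open>s\<close> with the indicator of \<open>S s\<close>. The mass that the trajectory has outside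
  \<open>S k\<close> is initially zero and grows in each step by at most the flow
  (lemma \<open>mass_outside_step\<close>), so it stays as small as one wishes. In an ergodic chain, however, every
  coordinate tends to the fixed positive number \<open>|S 0| / m\<close>, and the complement of \<open>S k\<close> contains at
  least one coordinate.

  \<^bold>\<open>Infinite flow implies ergodicity.\<close> Let \<open>M r x\<close> be the sum of the \<open>r\<close> largest entries of \<open>x\<close>. A doubly
  stochastic matrix can only decrease \<open>M r\<close>, and the decrease is quantitative: if the \<open>r\<close>-th and
  \<open>(r + 1)\<close>-st largest entries differ by at least \<open>g\<close>, then \<open>M r\<close> drops by at least \<open>g\<close> times half the
  flow between the sets of the \<open>r\<close> largest entries before and after the step
  (lemma \<open>top_sum_decrease\<close>). Along a nonnegative trajectory each \<open>M r\<close> converges, say to \<open>L r\<close>, and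
  hence so does the gap \<open>2 M r - M (r - 1) - M (r + 1)\<close> between these two entries. If its limit were
  positive for some \<open>0 < r < m\<close>, the decreases of \<open>M r\<close> would telescope to a finite bound on the total
  flow along the sets of the \<open>r\<close> largest entries, which form a regular sequence. So \<open>L\<close> is convex on
  \<open>{0..m}\<close> with \<open>L 0 = 0\<close>, which gives \<open>L 1 \<le> L m / m\<close>: in the limit the largest entry does not exceed
  the mean, and all entries tend to the mean.
\<close>

section \<open>Doubly stochastic matrices\<close>

lemma doubly_stochastic_matrix_iff:
  "doubly_stochastic_matrix A \<longleftrightarrow>
     (\<forall>i j. 0 \<le> A $ i $ j) \<and> (\<forall>i. (\<Sum>j\<in>UNIV. A $ i $ j) = 1) \<and> (\<forall>j. (\<Sum>i\<in>UNIV. A $ i $ j) = 1)"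
  unfolding doubly_stochastic_matrix_def stochastic_matrix_def transpose_def by auto

lemma doubly_stochasticD:
  assumes "doubly_stochastic_matrix A"
  shows "0 \<le> A $ i $ j" "(\<Sum>j\<in>UNIV. A $ i $ j) = 1" "(\<Sum>i\<in>UNIV. A $ i $ j) = 1"
  using assms by (auto simp: doubly_stochastic_matrix_iff)

lemma doubly_stochastic_mult_bounds:
  assumes A: "doubly_stochastic_matrix A" and x: "\<And>j. 0 \<le> x $ j \<and> x $ j \<le> 1"
  shows "0 \<le> (A *v x) $ i \<and> (A *v x) $ i \<le> 1"
proof
  show "0 \<le> (A *v x) $ i"
    using x doubly_stochasticD(1)[OF A] by (auto simp: matrix_vector_mult_def intro!: sum_nonneg)
  have "(A *v x) $ i \<le> (\<Sum>j\<in>UNIV. A $ i $ j)"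
    using x doubly_stochasticD(1)[OF A]
    by (auto simp: matrix_vector_mult_def intro!: sum_mono mult_left_le)
  then show "(A *v x) $ i \<le> 1"
    using doubly_stochasticD(2)[OF A] by simp
qed

lemma doubly_stochastic_mult_sum:
  assumes A: "doubly_stochastic_matrix A"
  shows "(\<Sum>i\<in>UNIV. (A *v x) $ i) = (\<Sum>i\<in>UNIV. x $ i)"
proof -
  have "(\<Sum>i\<in>UNIV. (A *v x) $ i) = (\<Sum>i\<in>UNIV. \<Sum>j\<in>UNIV. A $ i $ j * x $ j)"
    by (simp add: matrix_vector_mult_def)
  also have "\<dots> = (\<Sum>j\<in>UNIV. \<Sum>i\<in>UNIV. A $ i $ j * x $ j)"
    by (rule sum.swap)
  also have "\<dots> = (\<Sum>j\<in>UNIV. x $ j)"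
    using doubly_stochasticD(3)[OF A] by (simp flip: sum_distrib_right)
  finally show ?thesis .
qed

lemma backward_product_mult_Suc:
  "s \<le> k \<Longrightarrow> backward_product A (Suc k) s *v x = A k *v (backward_product A k s *v x)"
  by (simp add: matrix_vector_mul_assoc)

lemma backward_product_trivial: "k \<le> s \<Longrightarrow> backward_product A k s = mat 1"
  by (cases k) auto

lemma backward_product_mult_bounds:
  assumes "\<And>k. doubly_stochastic_matrix (A k)" and "\<And>j. 0 \<le> x $ j \<and> x $ j \<le> 1"
  shows "0 \<le> (backward_product A k s *v x) $ i \<and> (backward_product A k s *v x) $ i \<le> 1"
proof (induction k arbitrary: i)
  case (Suc k)
  show ?case
  proof (cases "s \<le> k")
    case True
    show ?thesis
      unfolding backward_product_mult_Suc[OF True]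
      by (rule doubly_stochastic_mult_bounds[OF assms(1) Suc.IH])
  qed (use assms in auto)
qed (use assms in auto)

lemma backward_product_mult_sum:
  assumes "\<And>k. doubly_stochastic_matrix (A k)"
  shows "(\<Sum>i\<in>UNIV. (backward_product A k s *v x) $ i) = (\<Sum>i\<in>UNIV. x $ i)"
proof (induction k)
  case (Suc k)
  show ?case
  proof (cases "s \<le> k")
    case True
    show ?thesis
      unfolding backward_product_mult_Suc[OF True]
      by (simp add: doubly_stochastic_mult_sum[OF assms] Suc.IH)
  qed auto
qed auto

section \<open>Flow between sets of equal size\<close>

lemma set_flow_nonneg: "doubly_stochastic_matrix A \<Longrightarrow> 0 \<le> set_flow A T S"
  unfolding set_flow_def by (intro add_nonneg_nonneg sum_nonneg) (auto dest: doubly_stochasticD(1))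

lemma sum_UNIV_split: "sum f (UNIV :: 'a::finite set) = sum f S + sum f (- S)"
  by (metis Compl_partition finite disjoint_iff ComplD sum.union_disjoint)

text \<open>Rows indexed by \<open>T\<close> and columns indexed by \<open>S\<close> carry the same total weight, and the two
  off-diagonal blocks are what remains of them after removing their common block \<open>T \<times> S\<close>.\<close>
lemma flow_balance:
  assumes A: "doubly_stochastic_matrix A" and card: "card T = card S"
  shows "(\<Sum>i\<in>T. \<Sum>j\<in>-S. A $ i $ j) = (\<Sum>i\<in>-T. \<Sum>j\<in>S. A $ i $ j)"
proof -
  have "(\<Sum>i\<in>T. \<Sum>j\<in>S. A $ i $ j) + (\<Sum>i\<in>T. \<Sum>j\<in>-S. A $ i $ j) = (\<Sum>i\<in>T. \<Sum>j\<in>UNIV. A $ i $ j)"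
    by (simp add: sum_UNIV_split[of _ S] sum.distrib)
  also have "\<dots> = card T"
    using doubly_stochasticD(2)[OF A] by simp
  also have "\<dots> = card S" using card by simp
  also have "\<dots> = (\<Sum>j\<in>S. \<Sum>i\<in>UNIV. A $ i $ j)"
    using doubly_stochasticD(3)[OF A] by simp
  also have "\<dots> = (\<Sum>i\<in>UNIV. \<Sum>j\<in>S. A $ i $ j)" by (rule sum.swap)
  also have "\<dots> = (\<Sum>i\<in>T. \<Sum>j\<in>S. A $ i $ j) + (\<Sum>i\<in>-T. \<Sum>j\<in>S. A $ i $ j)"
    by (rule sum_UNIV_split)
  finally show ?thesis by simp
qed

text \<open>The mass arriving outside \<open>T\<close> comes either from inside \<open>S\<close>, where entries at most 1 make the flow
  an upper bound, or from outside \<open>S\<close>, where column sums 1 prevent any gain.\<close>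
lemma mass_outside_step:
  assumes A: "doubly_stochastic_matrix A" and x: "\<And>j. 0 \<le> x $ j \<and> x $ j \<le> 1"
  shows "(\<Sum>i\<in>-T. (A *v x) $ i) \<le> (\<Sum>j\<in>-S. x $ j) + set_flow A T S"
proof -
  have "(\<Sum>i\<in>-T. (A *v x) $ i)
      = (\<Sum>i\<in>-T. \<Sum>j\<in>S. A $ i $ j * x $ j) + (\<Sum>i\<in>-T. \<Sum>j\<in>-S. A $ i $ j * x $ j)"
    by (simp add: matrix_vector_mult_def sum_UNIV_split[of _ S] sum.distrib)
  also have "(\<Sum>i\<in>-T. \<Sum>j\<in>S. A $ i $ j * x $ j) \<le> (\<Sum>i\<in>-T. \<Sum>j\<in>S. A $ i $ j)"
    using x doubly_stochasticD(1)[OF A] by (intro sum_mono mult_left_le) auto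
  also have "\<dots> \<le> set_flow A T S"
    unfolding set_flow_def using doubly_stochasticD(1)[OF A] by (simp add: sum_nonneg)
  also have "(\<Sum>i\<in>-T. \<Sum>j\<in>-S. A $ i $ j * x $ j) \<le> (\<Sum>i\<in>UNIV. \<Sum>j\<in>-S. A $ i $ j * x $ j)"
    using x doubly_stochasticD(1)[OF A] by (intro sum_mono2) (auto intro!: sum_nonneg)
  also have "\<dots> = (\<Sum>j\<in>-S. \<Sum>i\<in>UNIV. A $ i $ j * x $ j)" by (rule sum.swap)
  also have "\<dots> = (\<Sum>j\<in>-S. x $ j)"
    using doubly_stochasticD(3)[OF A] by (simp flip: sum_distrib_right)
  finally show ?thesis by simp
qed

text \<open>By \<open>flow_balance\<close>, the weight \<open>f\<close> by which \<open>T\<close> averages over indices outside \<open>S\<close> equals the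
  weight by which it misses indices in \<open>S\<close>. So passing from \<open>S\<close> to \<open>T\<close> trades entries of size at
  least \<open>t + g\<close> for entries of size at most \<open>t\<close>, in the amount \<open>f\<close>.\<close>
lemma sum_decrease_ge_flow:
  fixes A :: "real^'n^'n"
  assumes A: "doubly_stochastic_matrix A" and card: "card T = card S"
    and low: "\<And>j. j \<notin> S \<Longrightarrow> x $ j \<le> t" and high: "\<And>j. j \<in> S \<Longrightarrow> t + g \<le> x $ j"
  shows "g * (set_flow A T S / 2) \<le> (\<Sum>j\<in>S. x $ j) - (\<Sum>i\<in>T. (A *v x) $ i)"
proof -
  define f where "f = (\<Sum>i\<in>-T. \<Sum>j\<in>S. A $ i $ j)"
  have f': "(\<Sum>i\<in>T. \<Sum>j\<in>-S. A $ i $ j) = f"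
    unfolding f_def by (rule flow_balance[OF A card])
  have flow: "set_flow A T S / 2 = f"
    unfolding set_flow_def f' by (simp add: f_def)
  have "(\<Sum>j\<in>S. x $ j) = (\<Sum>j\<in>S. \<Sum>i\<in>UNIV. A $ i $ j * x $ j)"
    using doubly_stochasticD(3)[OF A] by (simp flip: sum_distrib_right)
  also have "\<dots> = (\<Sum>i\<in>UNIV. \<Sum>j\<in>S. A $ i $ j * x $ j)" by (rule sum.swap)
  also have "\<dots> = (\<Sum>i\<in>T. \<Sum>j\<in>S. A $ i $ j * x $ j) + (\<Sum>i\<in>-T. \<Sum>j\<in>S. A $ i $ j * x $ j)"
    by (rule sum_UNIV_split)
  finally have S: "(\<Sum>j\<in>S. x $ j) = \<dots>" .
  have T: "(\<Sum>i\<in>T. (A *v x) $ i)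
      = (\<Sum>i\<in>T. \<Sum>j\<in>S. A $ i $ j * x $ j) + (\<Sum>i\<in>T. \<Sum>j\<in>-S. A $ i $ j * x $ j)"
    by (simp add: matrix_vector_mult_def sum_UNIV_split[of _ S] sum.distrib)
  have "f * (t + g) = (\<Sum>i\<in>-T. \<Sum>j\<in>S. A $ i $ j * (t + g))"
    by (simp add: f_def sum_distrib_right)
  also have "\<dots> \<le> (\<Sum>i\<in>-T. \<Sum>j\<in>S. A $ i $ j * x $ j)"
    using high doubly_stochasticD(1)[OF A] by (intro sum_mono mult_left_mono) auto
  finally have 1: "f * (t + g) \<le> \<dots>" .
  have "(\<Sum>i\<in>T. \<Sum>j\<in>-S. A $ i $ j * x $ j) \<le> (\<Sum>i\<in>T. \<Sum>j\<in>-S. A $ i $ j * t)"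
    using low doubly_stochasticD(1)[OF A] by (intro sum_mono mult_left_mono) auto
  also have "\<dots> = f * t"
    by (simp flip: f' add: sum_distrib_right)
  finally have 2: "(\<Sum>i\<in>T. \<Sum>j\<in>-S. A $ i $ j * x $ j) \<le> f * t" .
  show ?thesis
    using 1 2 unfolding S T flow by (simp add: algebra_simps)
qed

section \<open>Sums of the largest entries\<close>

definition top_sum :: "nat \<Rightarrow> real^'n \<Rightarrow> real" where
  "top_sum r x = Max ((\<lambda>S. \<Sum>i\<in>S. x $ i) ` {S. card S = r})"

definition top_set :: "nat \<Rightarrow> real^'n \<Rightarrow> 'n set" where
  "top_set r x = (SOME S. card S = r \<and> (\<Sum>i\<in>S. x $ i) = top_sum r x)"

text \<open>For \<open>0 < r < m\<close> this is the difference of the \<open>r\<close>-th and the \<open>(r + 1)\<close>-st largest entry. Written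
  through \<open>top_sum\<close>, it inherits convergence along trajectories without any sorting of vectors.\<close>
definition top_gap :: "nat \<Rightarrow> real^'n \<Rightarrow> real" where
  "top_gap r x = 2 * top_sum r x - top_sum (r - 1) x - top_sum (r + 1) x"

lemma sum_le_top_sum: "card S = r \<Longrightarrow> (\<Sum>i\<in>S. x $ i) \<le> top_sum r x"
  unfolding top_sum_def by (rule Max_ge) auto

lemma top_set:
  fixes x :: "real^'n"
  assumes "r \<le> CARD('n)"
  shows "card (top_set r x) = r" "(\<Sum>i\<in>top_set r x. x $ i) = top_sum r x"
proof -
  obtain S0 :: "'n set" where "card S0 = r"
    using obtain_subset_with_card_n[OF assms] by metis
  then have "top_sum r x \<in> (\<lambda>S. \<Sum>i\<in>S. x $ i) ` {S. card S = r}"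
    unfolding top_sum_def by (intro Max_in) auto
  then have "\<exists>S. card S = r \<and> (\<Sum>i\<in>S. x $ i) = top_sum r x" by auto
  from someI_ex[OF this]
  show "card (top_set r x) = r" "(\<Sum>i\<in>top_set r x. x $ i) = top_sum r x"
    unfolding top_set_def by auto
qed

text \<open>Exchange arguments: compare the top set with the competitors that swap \<open>i\<close> for \<open>j\<close>, that drop \<open>i\<close>,
  and that add \<open>j\<close>, which have \<open>r\<close>, \<open>r - 1\<close> and \<open>r + 1\<close> elements.\<close>
lemma top_set_separated:
  fixes x :: "real^'n"
  assumes r: "r \<le> CARD('n)" and i: "i \<in> top_set r x" and j: "j \<notin> top_set r x"
  shows "x $ j \<le> x $ i" "x $ j + top_gap r x \<le> x $ i"
proof -
  let ?S = "top_set r x"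
  have r0: "r \<noteq> 0" using i top_set(1)[OF r, of x] card_gt_0_iff[of "top_set r x"] by auto
  have minus: "(\<Sum>k\<in>?S - {i}. x $ k) = top_sum r x - x $ i"
    using i top_set(2)[OF r, of x] by (simp add: sum_diff1)
  have "card (insert j (?S - {i})) = r"
    using i j r0 top_set(1)[OF r, of x] by simp
  from sum_le_top_sum[OF this, of x] show "x $ j \<le> x $ i"
    using j minus by simp
  have "card (?S - {i}) = r - 1"
    using i top_set(1)[OF r, of x] by simp
  from sum_le_top_sum[OF this, of x] have "top_sum r x - x $ i \<le> top_sum (r - 1) x"
    using minus by simp
  moreover have "card (insert j ?S) = r + 1"
    using j top_set(1)[OF r, of x] by simp
  from sum_le_top_sum[OF this, of x] have "x $ j + top_sum r x \<le> top_sum (r + 1) x"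
    using j top_set(2)[OF r, of x] by simp
  ultimately show "x $ j + top_gap r x \<le> x $ i"
    unfolding top_gap_def by simp
qed

lemma separating_threshold:
  fixes f :: "'a::finite \<Rightarrow> real"
  assumes "\<And>i j. i \<in> S \<Longrightarrow> j \<notin> S \<Longrightarrow> f j + g \<le> f i"
  obtains t where "\<And>j. j \<notin> S \<Longrightarrow> f j \<le> t" "\<And>i. i \<in> S \<Longrightarrow> t + g \<le> f i"
proof (cases "S = UNIV")
  case True
  (* Without indices outside S there is only the lower bound to meet. *)
  show ?thesis
  proof (rule that[of "Min (range f) - g"])
    show "\<And>i. Min (range f) - g + g \<le> f i" by simp
  qed (use True in auto)
next
  case False
  then have "Max (f ` (- S)) \<in> f ` (- S)" by (intro Max_in) auto
  then show ?thesis using assms by (intro that[of "Max (f ` (- S))"]) auto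
qed

lemma top_sum_decrease:
  fixes x :: "real^'n"
  assumes A: "doubly_stochastic_matrix A" and r: "r \<le> CARD('n)"
    and sep: "\<And>i j. i \<in> top_set r x \<Longrightarrow> j \<notin> top_set r x \<Longrightarrow> x $ j + g \<le> x $ i"
  shows "g * (set_flow A (top_set r (A *v x)) (top_set r x) / 2) \<le> top_sum r x - top_sum r (A *v x)"
proof -
  from sep obtain t where "\<And>j. j \<notin> top_set r x \<Longrightarrow> x $ j \<le> t"
    "\<And>i. i \<in> top_set r x \<Longrightarrow> t + g \<le> x $ i"
    using separating_threshold[of "top_set r x" "\<lambda>i. x $ i" g] by metis
  from sum_decrease_ge_flow[where S = "top_set r x" and T = "top_set r (A *v x)", OF A _ this]
  show ?thesis
    by (simp add: top_set[OF r])
qed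

lemma top_sum_antimono:
  fixes x :: "real^'n"
  assumes "doubly_stochastic_matrix A" "r \<le> CARD('n)"
  shows "top_sum r (A *v x) \<le> top_sum r x"
  using top_sum_decrease[OF assms, of x 0] top_set_separated(1)[OF assms(2)] by simp

lemma top_sum_0: "top_sum 0 x = 0"
  using top_set[of 0 x] by simp

lemma top_sum_all: "top_sum CARD('n) (x :: real^'n) = (\<Sum>i\<in>UNIV. x $ i)"
  using top_set[of "CARD('n)" x] by (metis card_eq_UNIV_imp_eq_UNIV finite order_refl)

lemma component_le_top_sum: "x $ i \<le> top_sum 1 x"
  using sum_le_top_sum[of "{i}" 1 x] by simp

section \<open>Infinite flow forces consensus\<close>

lemma summable_if_eventually_telescoping:
  fixes u f :: "nat \<Rightarrow> real"
  assumes u: "u \<longlonglongrightarrow> L" and f: "\<And>k. 0 \<le> f k"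
    and ev: "eventually (\<lambda>k. f k \<le> u k - u (Suc k)) sequentially"
  shows "summable f"
proof (rule summable_comparison_test_ev)
  show "eventually (\<lambda>k. norm (f k) \<le> u k - u (Suc k)) sequentially"
    using ev f by simp
  show "summable (\<lambda>k. u k - u (Suc k))"
    using telescope_summable'[OF u] .
qed

lemma convex_sequence_ge_linear:
  fixes L :: "nat \<Rightarrow> real"
  assumes "L 0 = 0" and "\<And>r. 0 < r \<Longrightarrow> r < m \<Longrightarrow> 2 * L r \<le> L (r - 1) + L (r + 1)" and "r \<le> m"
  shows "real r * L 1 \<le> L r"
proof -
  have slope: "L 1 \<le> L (Suc q) - L q" if "q < m" for q
    using that
  proof (induction q)
    case (Suc q)
    then show ?case using assms(2)[of "Suc q"] by simp
  qed (simp add: assms(1))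
  show ?thesis
    using \<open>r \<le> m\<close>
  proof (induction r)
    case (Suc r)
    then show ?case using slope[of r] by (simp add: algebra_simps)
  qed (simp add: assms(1))
qed

text \<open>The infinite flow property is applied to the sets of the \<open>r\<close> largest entries, one \<open>r\<close> at a time; it
  closes every gap in the limit. Only steps from time \<open>s\<close> on are constrained, because
  finitely many terms do not affect whether a flow is finite.\<close>
lemma absolute_infinite_flow_imp_consensus:
  fixes A :: "nat \<Rightarrow> real^'n^'n" and x :: "nat \<Rightarrow> real^'n"
  assumes A: "\<And>k. doubly_stochastic_matrix (A k)" and flow: "absolute_infinite_flow A"
    and step: "\<And>k. s \<le> k \<Longrightarrow> x (Suc k) = A k *v x k"
    and nonneg: "\<And>k i. 0 \<le> x k $ i"
    and sum: "\<And>k. (\<Sum>i\<in>UNIV. x k $ i) = \<sigma>"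
  shows "(\<lambda>k. x k $ i) \<longlonglongrightarrow> \<sigma> / CARD('n)"
proof -
  define L where "L r = lim (\<lambda>k. top_sum r (x k))" for r
  have lim: "(\<lambda>k. top_sum r (x k)) \<longlonglongrightarrow> L r" if r: "r \<le> CARD('n)" for r
  proof -
    have "decseq (\<lambda>k. top_sum r (x (k + s)))"
      by (rule decseq_SucI) (simp add: step top_sum_antimono[OF A r])
    moreover have "0 \<le> top_sum r (x (k + s))" for k
      unfolding top_set(2)[OF r, symmetric] by (simp add: sum_nonneg nonneg)
    ultimately have "convergent (\<lambda>k. top_sum r (x (k + s)))"
      by (metis decseq_convergent convergentI)
    then have "convergent (\<lambda>k. top_sum r (x k))"
      using convergent_ignore_initial_segment[of "\<lambda>k. top_sum r (x k)" s] by simp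
    then show ?thesis
      by (simp add: L_def convergent_LIMSEQ_iff)
  qed
  have gap_lim: "(\<lambda>k. top_gap r (x k)) \<longlonglongrightarrow> 2 * L r - L (r - 1) - L (r + 1)"
    if "0 < r" "r < CARD('n)" for r
    unfolding top_gap_def using that by (intro tendsto_intros lim) auto
  have no_gap: "2 * L r - L (r - 1) - L (r + 1) \<le> 0" if r: "0 < r" "r < CARD('n)" for r
  proof (rule ccontr)
    define G where "G = 2 * L r - L (r - 1) - L (r + 1)"
    define S where "S k = top_set r (x k)" for k
    assume "\<not> ?thesis"
    then have G: "0 < G" unfolding G_def by simp
    have card: "card (S k) = r" for k
      unfolding S_def using r by (simp add: top_set)
    have "S k \<noteq> UNIV" for k
      using card[of k] r by auto
    then have "regular_sequence S"
      unfolding regular_sequence_def using card r by auto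
    then have "total_flow A S = \<infinity>"
      using flow unfolding absolute_infinite_flow_def by blast
    moreover
    have gap: "eventually (\<lambda>k. G / 2 < top_gap r (x k)) sequentially"
      using gap_lim[OF r] G unfolding G_def by (intro order_tendstoD(1)) auto
    (* The factor G / 2 is an eventual lower bound of the gap; the other 1 / 2 is
       because set_flow counts both off-diagonal blocks, which are equal. *)
    have "summable (\<lambda>k. G / 2 * (set_flow (A k) (S (Suc k)) (S k) / 2))"
    proof (rule summable_if_eventually_telescoping)
      show "(\<lambda>k. top_sum r (x k)) \<longlonglongrightarrow> L r" using lim r by simp
      show "0 \<le> G / 2 * (set_flow (A k) (S (Suc k)) (S k) / 2)" for k
        using G by (simp add: set_flow_nonneg[OF A])
      show "eventually (\<lambda>k. G / 2 * (set_flow (A k) (S (Suc k)) (S k) / 2)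
              \<le> top_sum r (x k) - top_sum r (x (Suc k))) sequentially"
        using gap eventually_ge_at_top[of s]
      proof eventually_elim
        case (elim k)
        have "x k $ j + G / 2 \<le> x k $ i" if "i \<in> top_set r (x k)" "j \<notin> top_set r (x k)" for i j
          using top_set_separated(2)[OF _ that] r elim(1) by simp
        from top_sum_decrease[where r = r, OF A[of k] _ this] show ?case
          unfolding S_def step[OF elim(2)] using r by simp
      qed
    qed
    then have "summable (\<lambda>k. set_flow (A k) (S (Suc k)) (S k))"
      using G by (simp add: summable_cmult_iff summable_divide_iff)
    then have "total_flow A S \<noteq> \<infinity>"
      unfolding total_flow_def by (subst suminf_ennreal2) (auto simp: set_flow_nonneg[OF A])
    ultimately show False by simp
  qed
  have L0: "L 0 = 0"
    using lim[of 0] by (simp add: top_sum_0 LIMSEQ_const_iff)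
  have "2 * L r \<le> L (r - 1) + L (r + 1)" if "0 < r" "r < CARD('n)" for r
    using no_gap[OF that] by simp
  from convex_sequence_ge_linear[OF L0 this order_refl]
  have "CARD('n) * L 1 \<le> L CARD('n)" by simp
  also have "L CARD('n) = \<sigma>"
    using lim[of "CARD('n)"] by (simp add: top_sum_all sum LIMSEQ_const_iff)
  finally have L1_le: "CARD('n) * L 1 \<le> \<sigma>" .
  have one: "1 \<le> CARD('n)" by (simp add: Suc_leI)
  have "\<sigma> \<le> CARD('n) * top_sum 1 (x k)" for k
    using sum_mono[of UNIV "\<lambda>i. x k $ i" "\<lambda>_. top_sum 1 (x k)"] component_le_top_sum[of "x k"]
    by (simp add: sum)
  then have "\<sigma> \<le> CARD('n) * L 1"
    by (intro LIMSEQ_le_const[OF tendsto_mult_left[OF lim[OF one]]]) auto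
  with L1_le have L1: "L 1 = \<sigma> / CARD('n)"
    by (simp add: field_simps)
  (* The largest entry also bounds each entry from below, as it bounds the other m - 1. *)
  have lower: "\<sigma> - (CARD('n) - 1) * top_sum 1 (x k) \<le> x k $ i" for k
  proof -
    have "(\<Sum>j\<in>UNIV - {i}. x k $ j) \<le> (CARD('n) - 1) * top_sum 1 (x k)"
      using sum_mono[of "UNIV - {i}" "\<lambda>j. x k $ j" "\<lambda>_. top_sum 1 (x k)"]
        component_le_top_sum[of "x k"] by simp
    then show ?thesis
      using sum[of k] by (simp add: sum_diff1)
  qed
  have "(\<lambda>k. \<sigma> - (CARD('n) - 1) * top_sum 1 (x k)) \<longlonglongrightarrow> \<sigma> - (CARD('n) - 1) * L 1"
    using lim[OF one] by (intro tendsto_intros)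
  also have "\<sigma> - (CARD('n) - 1) * L 1 = \<sigma> / CARD('n)"
    unfolding L1 using one by (simp add: field_simps of_nat_diff)
  finally have "(\<lambda>k. \<sigma> - (CARD('n) - 1) * top_sum 1 (x k)) \<longlonglongrightarrow> \<sigma> / CARD('n)" .
  then show ?thesis
    by (rule tendsto_sandwich[OF always_eventually always_eventually _ lim[OF one, unfolded L1],
          rotated 2]) (intro allI lower component_le_top_sum)+
qed

lemma columnvector_rowvector_nth:
  "((columnvector (vec 1) :: real^1^'n) ** rowvector v) $ i $ j = v $ j"
  by (simp add: matrix_matrix_mult_def columnvector_def rowvector_def)

lemma absolute_infinite_flow_imp_ergodic:
  fixes A :: "nat \<Rightarrow> real^'n^'n"
  assumes A: "\<And>k. doubly_stochastic_matrix (A k)" and flow: "absolute_infinite_flow A"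
  shows "ergodic_chain A"
proof -
  define v :: "real^'n" where "v = (\<chi> j. 1 / CARD('n))"
  have v: "stochastic_vector v"
    by (simp add: stochastic_vector_def v_def)
  have "(\<lambda>k. backward_product A k s) \<longlonglongrightarrow> (columnvector (vec 1) :: real^1^'n) ** rowvector v" for s
  proof (intro vec_tendstoI)
    fix i j :: 'n
    let ?x = "\<lambda>k. backward_product A k s *v axis j 1"
    have "(\<lambda>k. ?x k $ i) \<longlonglongrightarrow> 1 / CARD('n)"
    proof (rule absolute_infinite_flow_imp_consensus[OF A flow])
      show "\<And>k. s \<le> k \<Longrightarrow> ?x (Suc k) = A k *v ?x k"
        by (rule backward_product_mult_Suc)
      show "\<And>k i. 0 \<le> ?x k $ i"
        using backward_product_mult_bounds[OF A, of "axis j 1"] by (simp add: axis_def)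
      show "\<And>k. (\<Sum>i\<in>UNIV. ?x k $ i) = 1"
        unfolding backward_product_mult_sum[OF A] by (simp add: axis_def)
    qed
    then show "(\<lambda>k. backward_product A k s $ i $ j)
        \<longlonglongrightarrow> ((columnvector (vec 1) :: real^1^'n) ** rowvector v) $ i $ j"
      unfolding columnvector_rowvector_nth
      by (simp add: v_def matrix_vector_mult_basis column_def)
  qed
  then show ?thesis
    unfolding ergodic_chain_def using v by blast
qed

section \<open>Finite flow prevents ergodicity\<close>

text \<open>A trajectory started at time \<open>s\<close> from the indicator of \<open>S s\<close> follows the moving sets \<open>S k\<close> up to
  the accumulated flow.\<close>
lemma mass_outside_le_flow:
  assumes A: "\<And>k. doubly_stochastic_matrix (A k)"
  shows "(\<Sum>i\<in>-S (s + n). (backward_product A (s + n) s *v (\<chi> i. of_bool (i \<in> S s))) $ i)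
    \<le> (\<Sum>k<n. set_flow (A (s + k)) (S (Suc (s + k))) (S (s + k)))"
proof (induction n)
  case 0
  show ?case by (simp add: backward_product_trivial)
next
  case (Suc n)
  let ?x = "\<lambda>k. backward_product A k s *v (\<chi> i. of_bool (i \<in> S s))"
  have "\<And>j. 0 \<le> ?x (s + n) $ j \<and> ?x (s + n) $ j \<le> 1"
    by (intro backward_product_mult_bounds A) simp
  from mass_outside_step[OF A[of "s + n"] this, of "S (Suc (s + n))" "S (s + n)"] Suc.IH
  show ?case
    by (simp add: backward_product_mult_Suc del: backward_product.simps)
qed

text \<open>Conservation of mass identifies the common limit of all coordinates as the mean of \<open>x\<close>.\<close>
lemma ergodic_consensus_limit:
  fixes A :: "nat \<Rightarrow> real^'n^'n"
  assumes A: "\<And>k. doubly_stochastic_matrix (A k)" and "ergodic_chain A"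
  shows "(\<lambda>k. (backward_product A k s *v x) $ i) \<longlonglongrightarrow> (\<Sum>j\<in>UNIV. x $ j) / CARD('n)"
proof -
  obtain v where
    "(\<lambda>k. backward_product A k s) \<longlonglongrightarrow> (columnvector (vec 1) :: real^1^'n) ** rowvector v"
    using assms(2) unfolding ergodic_chain_def by blast
  then have "(\<lambda>k. backward_product A k s $ i $ j) \<longlonglongrightarrow> v $ j" for i j
    using tendsto_vec_nth[OF tendsto_vec_nth] columnvector_rowvector_nth by metis
  then have lim: "(\<lambda>k. (backward_product A k s *v x) $ i) \<longlonglongrightarrow> (\<Sum>j\<in>UNIV. v $ j * x $ j)" for i
    unfolding matrix_vector_mult_def vec_lambda_beta by (intro tendsto_sum tendsto_mult_right)
  then have "(\<lambda>k. \<Sum>i\<in>UNIV. (backward_product A k s *v x) $ i)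
      \<longlonglongrightarrow> (\<Sum>i\<in>(UNIV :: 'n set). \<Sum>j\<in>UNIV. v $ j * x $ j)"
    by (intro tendsto_intros)
  then have "(\<Sum>j\<in>UNIV. x $ j) = CARD('n) * (\<Sum>j\<in>UNIV. v $ j * x $ j)"
    unfolding backward_product_mult_sum[OF A] by (simp add: LIMSEQ_const_iff)
  then show ?thesis using lim[of i] by simp
qed

lemma ergodic_imp_absolute_infinite_flow:
  fixes A :: "nat \<Rightarrow> real^'n^'n"
  assumes A: "\<And>k. doubly_stochastic_matrix (A k)" and erg: "ergodic_chain A"
  shows "absolute_infinite_flow A"
  unfolding absolute_infinite_flow_def
proof (intro allI impI, rule ccontr)
  fix S :: "nat \<Rightarrow> 'n set"
  assume reg: "regular_sequence S" and fin: "total_flow A S \<noteq> \<infinity>"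
  define f where "f k = set_flow (A k) (S (Suc k)) (S k)" for k
  (* Half the limit of each coordinate: eventually a single index outside S k carries
     more mass than this, while the flow after time s is smaller than it. *)
  define c where "c = card (S 0) / (2 * CARD('n))"
  have card: "card (S k) = card (S 0)" and nonempty: "card (S 0) \<noteq> 0" and proper: "S k \<subset> UNIV" for k
    using reg unfolding regular_sequence_def by auto
  have c: "0 < c"
    unfolding c_def using nonempty by (intro divide_pos_pos) auto
  have f: "0 \<le> f k" for k
    unfolding f_def by (rule set_flow_nonneg[OF A])
  have "summable f"
    using fin f unfolding total_flow_def f_def by (intro summable_suminf_not_top) auto
  then obtain s where s: "\<bar>\<Sum>k. f (k + s)\<bar> < c"
    using suminf_exist_split[OF c, of f] by (metis order_refl real_norm_def)
  define x where "x k = backward_product A k s *v (\<chi> i. of_bool (i \<in> S s))" for k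
  have upper: "(\<Sum>i\<in>-S (s + n). x (s + n) $ i) < c" for n
  proof -
    have "(\<Sum>i\<in>-S (s + n). x (s + n) $ i) \<le> (\<Sum>k<n. f (k + s))"
      unfolding x_def f_def using mass_outside_le_flow[where A = A and S = S, OF A, of s n]
      by (simp add: add.commute)
    also have "\<dots> \<le> (\<Sum>k. f (k + s))"
      using \<open>summable f\<close> f by (intro sum_le_suminf) (auto simp: summable_iff_shift)
    finally show ?thesis using s by simp
  qed
  have "(\<lambda>k. x k $ i) \<longlonglongrightarrow> 2 * c" for i
    using ergodic_consensus_limit[OF A erg, of s "\<chi> i. of_bool (i \<in> S s)" i] card[of s]
    by (simp add: x_def c_def)
  then have "eventually (\<lambda>k. \<forall>i. c < x k $ i) sequentially"
    using c by (intro eventually_all_finite order_tendstoD(1)) auto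
  then obtain k where k: "s \<le> k" "\<And>i. c < x k $ i"
    unfolding eventually_sequentially by (metis nle_le)
  obtain i where i: "i \<in> - S k"
    using proper[of k] by auto
  have "c < x k $ i" by (rule k)
  also have "\<dots> \<le> (\<Sum>i\<in>-S k. x k $ i)"
  proof (rule member_le_sum[OF i])
    show "0 \<le> x k $ j" for j using k(2)[of j] c by simp
  qed simp
  also have "\<dots> < c" using upper[of "k - s"] k(1) by simp
  finally show False .
qed

theorem theorem5:
  fixes A :: "nat \<Rightarrow> real^'n^'n"
  assumes "\<And>k. doubly_stochastic_matrix (A k)"
  shows "ergodic_chain A \<longleftrightarrow> absolute_infinite_flow A"
  using ergodic_imp_absolute_infinite_flow[where A = A, OF assms]
    absolute_infinite_flow_imp_ergodic[where A = A, OF assms]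
  by blast

end
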